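(* Min-$\sum$|Prefixsum| can be solved in time $\mathcal{O}(n\log n)$ on instances $S=\{s_1,\dots,s_n\}$ that contain exactly one negative element and satisfy $\sum_{i=1}^n s_i=0$; likewise, it can be solved in time $\mathcal{O}(n\log n)$ on instances that contain exactly one positive element and satisfy $\sum_{i=1}^n s_i=0$.
   Context: Min-$\sum$|Prefixsum|: given a multiset $S=\{s_1,\dots,s_n\}$ of real numbers, find a permutation (bijection $\pi:\{1,\dots,n\}\to S$) minimizing $\sum_{i=1}^n\left|\sum_{j=1}^i\pi(j)\right|$. *)

theory Defs
  imports Complex_Main "HOL-Library.Landau_Symbols" "HOL-Combinatorics.Multiset_Permutations"
begin

section \<open>The optimization problem\<close>

text \<open>
  A bijection from positions to the elements of a multiset \<open>S\<close> is represented by the list of its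
  values, i.e. by an element of \<^const>\<open>permutations_of_multiset\<close> \<open>S\<close>; list positions start at 0.
\<close>

definition sum_abs_prefixsum :: "real list \<Rightarrow> real" where
  "sum_abs_prefixsum \<pi> = (\<Sum>i<length \<pi>. \<bar>\<Sum>j\<le>i. \<pi> ! j\<bar>)"

definition solves_min_sum_abs_prefixsum :: "real multiset \<Rightarrow> real list \<Rightarrow> bool" where
  "solves_min_sum_abs_prefixsum S \<pi> \<longleftrightarrow>
     is_arg_min sum_abs_prefixsum (\<lambda>\<sigma>. \<sigma> \<in> permutations_of_multiset S) \<pi>"


section \<open>Real RAM programs\<close>

text \<open>
  Running times refer to a real RAM with unit cost: it has registers and an indirectly addressable
  memory for natural numbers (used as indices and counters) and for exact real numbers. Reals
  support the field operations and comparison; there is no rounding and no conversion from reals to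
  indices. Indices support only addition, truncated subtraction and comparison (no multiplication,
  division or bit operations), which keeps unit cost reasonable. Real constants are integers, so that no
  information can be hidden in program constants. Control flow is structured (while programs).
\<close>

record state =
  ireg :: "nat \<Rightarrow> nat"
  imem :: "nat \<Rightarrow> nat"
  rreg :: "nat \<Rightarrow> real"
  rmem :: "nat \<Rightarrow> real"

datatype instr =
    Nop
  | IConst nat nat
  | IMove nat nat
  | IAdd nat nat nat
  | ISub nat nat nat
  | ILoad nat nat
  | IStore nat nat
  | RConst nat int
  | RMove nat nat
  | RAdd nat nat nat
  | RSub nat nat nat
  | RMul nat nat nat
  | RDiv nat nat nat
  | RLoad nat nat
  | RStore nat nat

text \<open>
  The first argument is the target, except for the store instructions, whose first argument is the
  index register holding the target address. Division by zero yields zero.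
\<close>

fun exec :: "instr \<Rightarrow> state \<Rightarrow> state" where
  "exec Nop s = s"
| "exec (IConst a c) s = s\<lparr>ireg := (ireg s)(a := c)\<rparr>"
| "exec (IMove a b) s = s\<lparr>ireg := (ireg s)(a := ireg s b)\<rparr>"
| "exec (IAdd a b c) s = s\<lparr>ireg := (ireg s)(a := ireg s b + ireg s c)\<rparr>"
| "exec (ISub a b c) s = s\<lparr>ireg := (ireg s)(a := ireg s b - ireg s c)\<rparr>"
| "exec (ILoad a b) s = s\<lparr>ireg := (ireg s)(a := imem s (ireg s b))\<rparr>"
| "exec (IStore a b) s = s\<lparr>imem := (imem s)(ireg s a := ireg s b)\<rparr>"
| "exec (RConst a k) s = s\<lparr>rreg := (rreg s)(a := real_of_int k)\<rparr>"
| "exec (RMove a b) s = s\<lparr>rreg := (rreg s)(a := rreg s b)\<rparr>"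
| "exec (RAdd a b c) s = s\<lparr>rreg := (rreg s)(a := rreg s b + rreg s c)\<rparr>"
| "exec (RSub a b c) s = s\<lparr>rreg := (rreg s)(a := rreg s b - rreg s c)\<rparr>"
| "exec (RMul a b c) s = s\<lparr>rreg := (rreg s)(a := rreg s b * rreg s c)\<rparr>"
| "exec (RDiv a b c) s = s\<lparr>rreg := (rreg s)(a := rreg s b / rreg s c)\<rparr>"
| "exec (RLoad a b) s = s\<lparr>rreg := (rreg s)(a := rmem s (ireg s b))\<rparr>"
| "exec (RStore a b) s = s\<lparr>rmem := (rmem s)(ireg s a := rreg s b)\<rparr>"

datatype test = ILess nat nat | IEq nat nat | RLess nat nat | REq nat nat

fun holds :: "test \<Rightarrow> state \<Rightarrow> bool" where
  "holds (ILess a b) s \<longleftrightarrow> ireg s a < ireg s b"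
| "holds (IEq a b) s \<longleftrightarrow> ireg s a = ireg s b"
| "holds (RLess a b) s \<longleftrightarrow> rreg s a < rreg s b"
| "holds (REq a b) s \<longleftrightarrow> rreg s a = rreg s b"

datatype prog =
    Instr instr
  | Seq prog prog
  | Cond test prog prog
  | While test prog

text \<open>
  \<open>runs p s t s'\<close>: started in \<open>s\<close>, program \<open>p\<close> halts in \<open>s'\<close> after executing exactly \<open>t\<close>
  instructions and tests.
\<close>

inductive runs :: "prog \<Rightarrow> state \<Rightarrow> nat \<Rightarrow> state \<Rightarrow> bool" where
  Instr: "runs (Instr i) s 1 (exec i s)"
| Seq: "runs p s t s' \<Longrightarrow> runs q s' u s'' \<Longrightarrow> runs (Seq p q) s (t + u) s''"
| CondTrue: "holds b s \<Longrightarrow> runs p s t s' \<Longrightarrow> runs (Cond b p q) s (1 + t) s'"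
| CondFalse: "\<not> holds b s \<Longrightarrow> runs q s t s' \<Longrightarrow> runs (Cond b p q) s (1 + t) s'"
| WhileFalse: "\<not> holds b s \<Longrightarrow> runs (While b p) s 1 s"
| WhileTrue: "holds b s \<Longrightarrow> runs p s t s' \<Longrightarrow> runs (While b p) s' u s'' \<Longrightarrow>
    runs (While b p) s (1 + t + u) s''"

inductive_cases runs_InstrE: "runs (Instr i) s t s'"
inductive_cases runs_SeqE: "runs (Seq p q) s t s'"
inductive_cases runs_CondE: "runs (Cond b p q) s t s'"
inductive_cases runs_WhileE: "runs (While b p) s t s'"

lemma runs_deterministic:
  assumes "runs p s t s'" and "runs p s u s''"
  shows "t = u \<and> s' = s''"
  using assms
proof (induction arbitrary: u s'' rule: runs.induct)
  case (Instr i s)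
  from Instr.prems show ?case by (rule runs_InstrE) simp
next
  case (Seq p s t s' q v r)
  from Seq.prems obtain t' v' r' where "u = t' + v'" "runs p s t' r'" "runs q r' v' s''"
    by (rule runs_SeqE)
  with Seq.IH show ?case by metis
next
  case (CondTrue b s p t s' q)
  from CondTrue.prems obtain t' where "u = 1 + t'" "runs p s t' s''"
    by (rule runs_CondE) (simp_all add: CondTrue.hyps)
  with CondTrue.IH show ?case by metis
next
  case (CondFalse b s q t s' p)
  from CondFalse.prems obtain t' where "u = 1 + t'" "runs q s t' s''"
    by (rule runs_CondE) (simp_all add: CondFalse.hyps)
  with CondFalse.IH show ?case by metis
next
  case (WhileFalse b s p)
  from WhileFalse.prems show ?case by (rule runs_WhileE) (simp_all add: WhileFalse.hyps)
next
  case (WhileTrue b s p t s' v r)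
  from WhileTrue.prems obtain t' v' r'
    where "u = 1 + t' + v'" "runs p s t' r'" "runs (While b p) r' v' s''"
    by (rule runs_WhileE) (simp_all add: WhileTrue.hyps)
  with WhileTrue.IH show ?case by metis
qed

text \<open>
  The input is stored in the first cells of the real memory, its length in index register 0; all
  other registers and cells are zero. The output is found in the first cells of the real memory.
\<close>

definition init_state :: "real list \<Rightarrow> state" where
  "init_state xs = \<lparr>ireg = (\<lambda>_. 0)(0 := length xs), imem = (\<lambda>_. 0), rreg = (\<lambda>_. 0),
     rmem = (\<lambda>i. if i < length xs then xs ! i else 0)\<rparr>"

definition result :: "nat \<Rightarrow> state \<Rightarrow> real list" where
  "result n s = map (rmem s) [0..<n]"

text \<open>
  A single program has to handle the instances of all sizes, with the elements of the multiset given
  in arbitrary order. The running time is bounded in terms of the number of elements, uniformly in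
  their values; nothing is required outside the class \<open>I\<close> of instances.
\<close>

definition min_sum_abs_prefixsum_solvable_in_time ::
    "(nat \<Rightarrow> real) \<Rightarrow> real multiset set \<Rightarrow> bool" where
  "min_sum_abs_prefixsum_solvable_in_time f I \<longleftrightarrow>
     (\<exists>p T. T \<in> O(f) \<and>
       (\<forall>S\<in>I. \<forall>xs. mset xs = S \<longrightarrow>
         (\<exists>t s. runs p (init_state xs) t s \<and> real t \<le> T (size S) \<and>
           solves_min_sum_abs_prefixsum S (result (size S) s))))"

end

theory Submission
  imports Defs "HOL-Real_Asymp.Real_Asymp"
begin

text \<open>
  Let \<open>c\<close> be the element of the other sign and write an arrangement as \<open>A @ c # B\<close>. Since the
  total is zero, the absolute prefix sums are the sums of the prefixes of \<open>A\<close> and of the suffixes of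
  \<open>B\<close>, so the \<open>i\<close>-th element from \<open>c\<close> on either side is counted \<open>i\<close> times. The cost is therefore
  least if the elements, in order of decreasing absolute value, alternate between the two sides of
  \<open>c\<close>, going outwards. As \<open>c\<close> itself has the largest absolute value, sorting all elements by
  absolute value and alternating from the outside inwards solves both kinds of instances. Sorting is
  done by a merge sort that keeps its runs in a queue laid out consecutively in memory.
\<close>

section \<open>Optimality of the zigzag arrangement\<close>

text \<open>Entries are consumed in pairs from the outermost positions inwards, so the last entry of
  the list ends up in the middle.\<close>

fun zigzag :: "'a list \<Rightarrow> 'a list" where
  "zigzag [] = []"
| "zigzag [x] = [x]"
| "zigzag (x # y # xs) = x # zigzag xs @ [y]"

lemma zigzag_map: "zigzag (map f xs) = map f (zigzag xs)"
  by (induction xs rule: zigzag.induct) auto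

lemma mset_zigzag: "mset (zigzag xs) = mset xs"
  by (induction xs rule: zigzag.induct) auto

lemma sum_abs_prefixsum_take:
  "sum_abs_prefixsum xs = (\<Sum>i<length xs. \<bar>sum_list (take (Suc i) xs)\<bar>)"
  unfolding sum_abs_prefixsum_def
  by (intro sum.cong refl) (simp add: sum_list_sum_nth atLeast0LessThan
        flip: lessThan_Suc_atMost)

lemma sum_abs_prefixsum_uminus: "sum_abs_prefixsum (map uminus xs) = sum_abs_prefixsum xs"
  unfolding sum_abs_prefixsum_def by (simp add: sum_negf)

text \<open>Negation is a cost-preserving bijection between the arrangements of \<open>S\<close> and
  those of its mirror image, so optimality transfers back.\<close>

lemma solves_uminus:
  assumes "solves_min_sum_abs_prefixsum (image_mset uminus S) (map uminus xs)"
  shows "solves_min_sum_abs_prefixsum S xs"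
proof -
  have perm: "map uminus ys \<in> permutations_of_multiset (image_mset uminus S) \<longleftrightarrow>
      ys \<in> permutations_of_multiset S" for ys
  proof -
    have "inj (image_mset (uminus :: real \<Rightarrow> real))" by (intro multiset.inj_map) simp
    then show ?thesis by (simp add: permutations_of_multiset_def inj_eq)
  qed
  show ?thesis
    unfolding solves_min_sum_abs_prefixsum_def is_arg_min_def
  proof (intro conjI notI)
    show "xs \<in> permutations_of_multiset S"
      using assms perm unfolding solves_min_sum_abs_prefixsum_def is_arg_min_def by blast
    assume "\<exists>ys. ys \<in> permutations_of_multiset S \<and> sum_abs_prefixsum ys < sum_abs_prefixsum xs"
    then obtain ys where "ys \<in> permutations_of_multiset S" "sum_abs_prefixsum ys < sum_abs_prefixsum xs"
      by blast
    then have "map uminus ys \<in> permutations_of_multiset (image_mset uminus S)"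
      "sum_abs_prefixsum (map uminus ys) < sum_abs_prefixsum (map uminus xs)"
      by (simp_all only: perm sum_abs_prefixsum_uminus)
    then show False
      using assms unfolding solves_min_sum_abs_prefixsum_def is_arg_min_def by blast
  qed
qed

section \<open>The cost as a sum over layers around the centre\<close>

lemma sum_lessThan_add:
  fixes f :: "nat \<Rightarrow> 'a :: comm_monoid_add"
  shows "(\<Sum>i<m + n. f i) = (\<Sum>i<m. f i) + (\<Sum>i<n. f (m + i))"
  by (induction n) (simp_all add: add.assoc)

text \<open>A prefix reaching \<open>c\<close> has, up to sign, the sum of the suffix of
  \<open>B\<close> it leaves out, since the total is zero. Both sides are then indexed by the number
  \<open>j\<close> of omitted elements next to \<open>c\<close>, over a common range.\<close>

lemma sum_abs_prefixsum_split:
  assumes A: "\<forall>x\<in>set A. x \<ge> 0" and B: "\<forall>x\<in>set B. x \<ge> 0" and zero: "sum_list (A @ c # B) = 0"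
  shows "sum_abs_prefixsum (A @ c # B) =
    (\<Sum>j<length A + length B. sum_list (take (length A - j) A) + sum_list (drop j B))"
proof -
  have posA: "0 \<le> sum_list (take i A)" and posB: "0 \<le> sum_list (drop i B)" for i
    using A B by (auto intro!: sum_list_nonneg dest: in_set_takeD in_set_dropD)
  have "sum_abs_prefixsum (A @ c # B) =
      (\<Sum>i<length A + Suc (length B). \<bar>sum_list (take (Suc i) (A @ c # B))\<bar>)"
    by (simp add: sum_abs_prefixsum_take)
  also have "\<dots> = (\<Sum>i<length A. sum_list (take (Suc i) A)) +
      (\<Sum>i<Suc (length B). \<bar>sum_list (take (Suc (length A + i)) (A @ c # B))\<bar>)"
    unfolding sum_lessThan_add by (simp add: posA)
  \<comment> \<open>The summation index is reversed to count omitted elements; the extension of its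
    range that follows adds only empty prefixes.\<close>
  also have "(\<Sum>i<length A. sum_list (take (Suc i) A)) = (\<Sum>j<length A. sum_list (take (length A - j) A))"
    by (subst sum.nat_diff_reindex [symmetric]) (auto intro!: sum.cong simp: Suc_diff_Suc)
  also have "\<dots> = (\<Sum>j<length A + length B. sum_list (take (length A - j) A))"
    unfolding sum_lessThan_add by simp
  also have "(\<Sum>i<Suc (length B). \<bar>sum_list (take (Suc (length A + i)) (A @ c # B))\<bar>) =
      (\<Sum>i<Suc (length B). sum_list (drop i B))"
  proof (intro sum.cong refl)
    fix i
    have "sum_list A + (c + (sum_list (take i B) + sum_list (drop i B))) = 0"
      using zero unfolding sum_list_append [symmetric] by simp
    moreover have "sum_list (take (Suc (length A + i)) (A @ c # B)) = sum_list A + (c + sum_list (take i B))"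
      by simp
    ultimately show "\<bar>sum_list (take (Suc (length A + i)) (A @ c # B))\<bar> = sum_list (drop i B)"
      using posB[of i] by linarith
  qed
  also have "\<dots> = (\<Sum>i<length B + length A. sum_list (drop i B))"
    unfolding sum_lessThan_add by simp
  finally show ?thesis by (simp add: sum.distrib add.commute)
qed

text \<open>The \<open>j\<close> elements nearest to \<open>c\<close> on each side are together the
  last \<open>2 * j\<close> elements of \<open>xs\<close>, so a prefix of \<open>xs\<close> remains.
  Each pair of \<open>zigzag\<close> adds one element to either end.\<close>

lemma zigzag_snoc:
  fixes xs :: "real list"
  shows "\<exists>A B. zigzag (xs @ [c]) = A @ c # B \<and> mset (A @ B) = mset xs \<and>
    length A = (length xs + 1) div 2 \<and>
    (\<forall>j. sum_list (take (length A - j) A) + sum_list (drop j B) = sum_list (take (length xs - 2 * j) xs))"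
proof (induction xs rule: zigzag.induct)
  case 1
  show ?case by (intro exI[of _ "[]"]) simp
next
  case (2 x)
  have "sum_list (take (Suc 0 - j) [x]) = sum_list (take (Suc 0 - 2 * j) [x])" for j
    by (cases j) auto
  then show ?case by (intro exI[of _ "[x]"] exI[of _ "[]"]) simp
next
  case (3 x y xs)
  then obtain A B where AB: "zigzag (xs @ [c]) = A @ c # B" "mset (A @ B) = mset xs"
    "length A = (length xs + 1) div 2"
    and eq: "\<And>j. sum_list (take (length A - j) A) + sum_list (drop j B) =
      sum_list (take (length xs - 2 * j) xs)" by blast
  have "length A + length B = length xs"
    using AB(2) by (metis length_append size_mset)
  then have B: "length B = length xs div 2" using AB(3) by linarith
  have "sum_list (take (Suc (length A) - j) (x # A)) + sum_list (drop j (B @ [y])) =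
      sum_list (take (Suc (Suc (length xs)) - 2 * j) (x # y # xs))" for j
  proof -
    \<comment> \<open>Of the outer pair, both elements remain, only \<open>x\<close> remains, or
      neither does.\<close>
    consider "2 * j \<le> length xs" | "2 * j = Suc (length xs)" | "2 * j > Suc (length xs)"
      by linarith
    then show ?thesis
    proof cases
      case 1
      then have "j \<le> length A" "j \<le> length B" using AB(3) B by linarith+
      then show ?thesis using 1 eq[of j] by (simp add: Suc_diff_le)
    next
      case 2
      then have "j = length A" "j = Suc (length B)" using AB(3) B by linarith+
      then show ?thesis using 2 by simp
    next
      case 3
      then have "j > length A" "j > length B" using AB(3) B by linarith+
      then show ?thesis using 3 by simp
    qed
  qed
  then show ?case
    using AB by (intro exI[of _ "x # A"] exI[of _ "B @ [y]"]) simp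
qed

section \<open>Comparison with the smallest elements\<close>

lemma sum_mset_nonneg:
  fixes M :: "'a :: ordered_comm_monoid_add multiset"
  shows "\<forall>x\<in>#M. x \<ge> 0 \<Longrightarrow> sum_mset M \<ge> 0"
  by (induction M) auto

lemma mset_take_subseteq: "mset (take n xs) \<subseteq># mset xs"
  by (metis append_take_drop_id mset_append mset_subset_eq_add_left)

lemma mset_drop_subseteq: "mset (drop n xs) \<subseteq># mset xs"
  by (metis append_take_drop_id mset_append mset_subset_eq_add_right)

text \<open>Induction along the sorted list: the head is charged to some element of \<open>M\<close>
  at least as large. Nonnegativity covers the elements of \<open>M\<close> beyond the first
  \<open>k\<close>.\<close>

lemma sum_take_le_sum_mset:
  fixes xs :: "real list"
  assumes "sorted xs" "\<forall>x\<in>set xs. x \<ge> 0" "M \<subseteq># mset xs" "k \<le> size M"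
  shows "sum_list (take k xs) \<le> sum_mset M"
  using assms
proof (induction xs arbitrary: M k)
  case Nil
  then show ?case by simp
next
  case (Cons x xs)
  show ?case
  proof (cases k)
    case 0
    have "\<forall>y\<in>#M. y \<ge> 0" using Cons.prems(2,3) by (metis mset_subset_eqD set_mset_mset)
    then show ?thesis using 0 by (simp add: sum_mset_nonneg)
  next
    case (Suc k')
    then have "M \<noteq> {#}" using Cons.prems(4) by auto
    \<comment> \<open>Taking \<open>x\<close> itself whenever possible makes the rest of
      \<open>M\<close> fit into the tail; if \<open>x\<close> is absent, \<open>M\<close> already
      fits.\<close>
    define y where "y = (if x \<in># M then x else SOME y. y \<in># M)"
    have y: "y \<in># M" using \<open>M \<noteq> {#}\<close> by (auto simp: y_def intro: someI)
    have "y \<in> set (x # xs)" using y Cons.prems(3) by (metis mset_subset_eqD set_mset_mset)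
    then have "x \<le> y" using Cons.prems(1) by auto
    have "M - {#y#} \<subseteq># mset xs"
    proof (cases "x \<in># M")
      case True
      then show ?thesis using Cons.prems(3)
        by (simp add: y_def insert_subset_eq_iff subset_eq_diff_conv)
    next
      case False
      have "count M a \<le> count (mset xs) a" for a
        using mset_subset_eq_count[OF Cons.prems(3), of a] False
        by (cases "a = x") (simp_all add: not_in_iff)
      then have "M \<subseteq># mset xs" by (simp add: subseteq_mset_def)
      then show ?thesis by (meson diff_subset_eq_self subset_mset.order_trans)
    qed
    moreover have "k' \<le> size (M - {#y#})"
      using Suc Cons.prems(4) y by (simp add: size_Diff_singleton)
    ultimately have "sum_list (take k' xs) \<le> sum_mset (M - {#y#})"
      using Cons.IH Cons.prems(1,2) by simp
    moreover have "sum_mset M = y + sum_mset (M - {#y#})"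
      using multi_member_split[OF y] by auto
    ultimately show ?thesis using Suc \<open>x \<le> y\<close> by simp
  qed
qed

text \<open>
  When the element of the other sign sits between \<open>A\<close> and \<open>B\<close>, the \<open>j\<close>-th summands
  of \<open>sum_abs_prefixsum_split\<close> leave out at most the \<open>2 * j\<close> elements closest to it;
  the zigzag arrangement makes those the \<open>2 * j\<close> largest ones, for all \<open>j\<close> at once.
\<close>

lemma zigzag_optimal:
  assumes srt: "sorted xs" and pos: "\<forall>x\<in>set xs. x \<ge> 0" and zero: "sum_list (xs @ [c]) = 0"
  shows "solves_min_sum_abs_prefixsum (mset (xs @ [c])) (zigzag (xs @ [c]))"
proof -
  have split: "\<forall>x\<in>set A. x \<ge> 0" "\<forall>x\<in>set B. x \<ge> 0" "sum_list (A @ c # B) = 0"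
    "length A + length B = length xs" if "mset (A @ B) = mset xs" for A B
  proof -
    have "set A \<union> set B = set xs" using that by (metis set_append set_mset_mset)
    then show "\<forall>x\<in>set A. x \<ge> 0" "\<forall>x\<in>set B. x \<ge> 0" using pos by auto
    have "sum_list (A @ B) = sum_list xs" using that by (metis sum_mset_sum_list)
    then show "sum_list (A @ c # B) = 0" using zero by simp
    show "length A + length B = length xs" using that by (metis length_append size_mset)
  qed
  have "sum_abs_prefixsum (zigzag (xs @ [c])) \<le> sum_abs_prefixsum ys"
    if "ys \<in> permutations_of_multiset (mset (xs @ [c]))" for ys
  proof -
    have ys: "mset ys = mset (xs @ [c])" using that by (simp add: permutations_of_multiset_def)
    then have "c \<in> set ys" by (metis in_set_conv_decomp set_mset_mset)
    then obtain A B where AB: "ys = A @ c # B" by (meson split_list)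
    with ys have m: "mset (A @ B) = mset xs" by simp
    obtain A' B' where zz: "zigzag (xs @ [c]) = A' @ c # B'" "mset (A' @ B') = mset xs"
      "\<And>j. sum_list (take (length A' - j) A') + sum_list (drop j B') = sum_list (take (length xs - 2 * j) xs)"
      using zigzag_snoc[of xs c] by blast
    have "sum_list (take (length xs - 2 * j) xs) \<le> sum_list (take (length A - j) A) + sum_list (drop j B)"
      for j
    proof -
      let ?M = "mset (take (length A - j) A) + mset (drop j B)"
      have "?M \<subseteq># mset A + mset B"
        by (intro subset_mset.add_mono mset_take_subseteq mset_drop_subseteq)
      \<comment> \<open>A side with fewer than \<open>j\<close> elements loses fewer than
        \<open>j\<close>, so truncated subtraction only enlarges \<open>?M\<close>.\<close>
      moreover have "length xs - 2 * j \<le> size ?M"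
        using split(4)[OF m] by simp
      ultimately have "sum_list (take (length xs - 2 * j) xs) \<le> sum_mset ?M"
        using sum_take_le_sum_mset[OF srt pos] m by (simp only: mset_append)
      then show ?thesis by (simp only: sum_mset.union sum_mset_sum_list)
    qed
    then show ?thesis
      unfolding AB zz(1) sum_abs_prefixsum_split[OF split(1-3)[OF m]]
        sum_abs_prefixsum_split[OF split(1-3)[OF zz(2)]] split(4)[OF m] split(4)[OF zz(2)] zz(3)
      by (rule sum_mono)
  qed
  then show ?thesis
    unfolding solves_min_sum_abs_prefixsum_def is_arg_min_def
    by (auto simp: permutations_of_multiset_def mset_zigzag not_less)
qed

section \<open>Sorting by absolute value covers both sign classes\<close>

definition sorted_abs :: "real list \<Rightarrow> bool" where
  "sorted_abs xs \<longleftrightarrow> sorted (map abs xs)"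

lemma sorted_abs_uminus: "sorted_abs (map uminus xs) \<longleftrightarrow> sorted_abs xs"
  by (simp add: sorted_abs_def comp_def)

lemma zigzag_optimal_abs_nonneg:
  assumes "sorted_abs (xs @ [c])" "\<forall>x\<in>set xs. x \<ge> 0" "sum_list (xs @ [c]) = 0"
  shows "solves_min_sum_abs_prefixsum (mset (xs @ [c])) (zigzag (xs @ [c]))"
proof -
  have "map abs xs = xs" using assms(2) by (simp add: map_idI)
  then have "sorted xs" using assms(1) by (simp add: sorted_abs_def sorted_append)
  then show ?thesis using assms(2,3) by (rule zigzag_optimal)
qed

lemma uminus_sum_list_real: "sum_list (map uminus xs) = - sum_list (xs :: real list)"
  by (induction xs) auto

lemma zigzag_optimal_abs_nonpos:
  assumes "sorted_abs (xs @ [c])" "\<forall>x\<in>set xs. x \<le> 0" "sum_list (xs @ [c]) = 0"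
  shows "solves_min_sum_abs_prefixsum (mset (xs @ [c])) (zigzag (xs @ [c]))"
proof -
  have "solves_min_sum_abs_prefixsum (mset (map uminus xs @ [- c])) (zigzag (map uminus xs @ [- c]))"
    using assms(2,3) sorted_abs_uminus[of "xs @ [c]"] assms(1) uminus_sum_list_real[of "xs @ [c]"]
    by (intro zigzag_optimal_abs_nonneg) auto
  then have "solves_min_sum_abs_prefixsum (image_mset uminus (mset (xs @ [c])))
      (map uminus (zigzag (xs @ [c])))"
    by (simp flip: zigzag_map)
  then show ?thesis by (rule solves_uminus)
qed

text \<open>
  The last element of the sorted list need not be the negative one \<open>a\<close>: it may be \<open>- a\<close> if all
  remaining elements are zero, and then the roles of the two signs are exchanged.
\<close>

lemma zigzag_solves_one_negative:
  assumes srt: "sorted_abs xs" and one: "size {#s \<in># mset xs. s < 0#} = 1" and zero: "sum_list xs = 0"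
  shows "solves_min_sum_abs_prefixsum (mset xs) (zigzag xs)"
proof -
  have "xs \<noteq> []" using one by auto
  then obtain ys c where xs: "xs = ys @ [c]" by (meson rev_exhaust)
  show ?thesis
  proof (cases "c < 0")
    case True
    then have "{#s \<in># mset ys. s < 0#} = {#}" using one by (simp add: xs)
    then have "\<forall>x\<in>set ys. x \<ge> 0" by (auto simp: filter_mset_eq_mempty_iff not_less)
    then show ?thesis using srt zero zigzag_optimal_abs_nonneg unfolding xs by blast
  next
    case False
    have one': "size {#s \<in># mset ys. s < 0#} = 1" using one False by (simp add: xs)
    then obtain a where a: "{#s \<in># mset ys. s < 0#} = {#a#}" by (meson size_1_singleton_mset)
    then have "a \<in># {#s \<in># mset ys. s < 0#}" by simp
    then have a': "a < 0" "a \<in># mset ys" by auto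
    define R where "R = mset ys - {#a#}"
    have R: "mset ys = add_mset a R" using a'(2) by (simp add: R_def)
    have Rpos: "\<forall>x\<in>#R. x \<ge> 0" using a a'(1) by (auto simp: R filter_mset_eq_mempty_iff not_less)
    have ac: "\<bar>a\<bar> \<le> \<bar>c\<bar>" using srt a'(2) by (auto simp: xs sorted_abs_def sorted_append)
    have "sum_mset (mset xs) = 0" using zero by (simp only: sum_mset_sum_list)
    then have sum0: "a + c + sum_mset R = 0" by (simp add: xs R)
    \<comment> \<open>By \<open>ac\<close>, \<open>a + c\<close> is nonnegative, so the zero total
      forces all elements of \<open>R\<close> to vanish.\<close>
    have "x \<le> 0" if x: "x \<in># R" for x
    proof -
      obtain R' where R': "R = add_mset x R'" using multi_member_split[OF x] by blast
      have "sum_mset R' \<ge> 0" using Rpos by (simp add: sum_mset_nonneg R')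
      then show ?thesis using sum0 ac False a'(1) by (simp add: R')
    qed
    then have "\<forall>x\<in>#mset ys. x \<le> 0" using a'(1) by (auto simp: R)
    then have "\<forall>x\<in>set ys. x \<le> 0" by simp
    then show ?thesis using srt zero zigzag_optimal_abs_nonpos unfolding xs by blast
  qed
qed

text \<open>Absolute values ignore negation and \<open>zigzag\<close> commutes with it, so the
  mirrored instance settles this case.\<close>

lemma zigzag_solves_one_positive:
  assumes srt: "sorted_abs xs" and one: "size {#s \<in># mset xs. s > 0#} = 1" and zero: "sum_list xs = 0"
  shows "solves_min_sum_abs_prefixsum (mset xs) (zigzag xs)"
proof -
  have "size {#s \<in># mset (map uminus xs). s < 0#} = 1"
    using one by (simp add: filter_mset_image_mset)
  then have "solves_min_sum_abs_prefixsum (mset (map uminus xs)) (zigzag (map uminus xs))"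
    using srt zero by (intro zigzag_solves_one_negative) (simp_all add: sorted_abs_uminus uminus_sum_list_real)
  then have "solves_min_sum_abs_prefixsum (image_mset uminus (mset xs)) (map uminus (zigzag xs))"
    by (simp add: zigzag_map)
  then show ?thesis by (rule solves_uminus)
qed

section \<open>Total correctness with running time\<close>

text \<open>As \<open>runs\<close> is deterministic, existence of one halting run is total
  correctness. The postcondition also receives the step count.\<close>

definition wp :: "prog \<Rightarrow> (nat \<Rightarrow> state \<Rightarrow> bool) \<Rightarrow> state \<Rightarrow> bool" where
  "wp p Q s \<longleftrightarrow> (\<exists>t s'. runs p s t s' \<and> Q t s')"

lemma wp_mono: "wp p Q s \<Longrightarrow> (\<And>t s'. Q t s' \<Longrightarrow> R t s') \<Longrightarrow> wp p R s"
  by (auto simp: wp_def)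

text \<open>
  The rules do not mention the state on the left, as postconditions of sequences are partial
  applications of \<open>wp\<close>.
\<close>

lemma wp_Instr [simp]: "wp (Instr i) Q = (\<lambda>s. Q 1 (exec i s))"
  unfolding wp_def by (metis runs.Instr runs_InstrE)

lemma wp_Seq [simp]: "wp (Seq p q) Q = wp p (\<lambda>t. wp q (\<lambda>u. Q (t + u)))"
  unfolding wp_def by (blast intro: runs.Seq elim: runs_SeqE)

lemma wp_Cond [simp]:
  "wp (Cond b p q) Q = (\<lambda>s. if holds b s then wp p (\<lambda>t. Q (1 + t)) s else wp q (\<lambda>t. Q (1 + t)) s)"
proof
  fix s
  show "wp (Cond b p q) Q s = (if holds b s then wp p (\<lambda>t. Q (1 + t)) s else wp q (\<lambda>t. Q (1 + t)) s)"
    unfolding wp_def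
    by (cases "holds b s") (force intro: runs.CondTrue runs.CondFalse elim: runs_CondE)+
qed

text \<open>The potential \<open>\<Phi>\<close> pays for each iteration and its test, and therefore
  strictly decreases, which gives termination; the extra 1 is the final failing test.\<close>

lemma wp_While:
  fixes \<Phi> :: "state \<Rightarrow> nat"
  assumes "I s" and step: "\<And>s. I s \<Longrightarrow> holds b s \<Longrightarrow> wp p (\<lambda>t s'. I s' \<and> t + 1 + \<Phi> s' \<le> \<Phi> s) s"
  shows "wp (While b p) (\<lambda>t s'. I s' \<and> \<not> holds b s' \<and> t \<le> \<Phi> s + 1) s"
  using assms(1)
proof (induction "\<Phi> s" arbitrary: s rule: less_induct)
  case less
  show ?case
  proof (cases "holds b s")
    case False
    then have "runs (While b p) s 1 s" by (rule runs.WhileFalse)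
    then show ?thesis using less.prems False unfolding wp_def by (intro exI[of _ 1] exI[of _ s]) simp
  next
    case True
    then obtain t s' where 1: "runs p s t s'" "I s'" "t + 1 + \<Phi> s' \<le> \<Phi> s"
      using step less.prems unfolding wp_def by blast
    moreover have "\<Phi> s' < \<Phi> s" using 1(3) by simp
    ultimately obtain u s'' where 2: "runs (While b p) s' u s''" "I s''" "\<not> holds b s''" "u \<le> \<Phi> s' + 1"
      using less.hyps unfolding wp_def by blast
    have "runs (While b p) s (1 + t + u) s''" using True 1(1) 2(1) by (rule runs.WhileTrue)
    moreover have "1 + t + u \<le> \<Phi> s + 1" using 1(3) 2(4) by simp
    ultimately show ?thesis using 2(2,3) unfolding wp_def by blast
  qed
qed

text \<open>The closing \<open>Nop\<close> accounts for one additional step per block in all later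
  counts.\<close>

primrec block :: "prog list \<Rightarrow> prog" where
  "block [] = Instr Nop"
| "block (p # ps) = Seq p (block ps)"

definition straight :: "instr list \<Rightarrow> prog" where
  "straight is = block (map Instr is)"

lemma wp_straight [simp]: "wp (straight is) Q = (\<lambda>s. Q (length is + 1) (fold exec is s))"
  unfolding straight_def by (induction "is" arbitrary: Q) simp_all

section \<open>Merging\<close>

definition seg :: "(nat \<Rightarrow> real) \<Rightarrow> nat \<Rightarrow> nat \<Rightarrow> real list" where
  "seg m a b = map m [a..<b]"

lemma seg_empty [simp]: "b \<le> a \<Longrightarrow> seg m a b = []"
  by (simp add: seg_def)

lemma seg_Cons: "a < b \<Longrightarrow> seg m a b = m a # seg m (Suc a) b"
  by (simp add: seg_def upt_conv_Cons)

lemma seg_snoc: "a \<le> b \<Longrightarrow> seg m a (Suc b) = seg m a b @ [m b]"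
  by (simp add: seg_def)

lemma seg_single [simp]: "seg m a (Suc a) = [m a]"
  by (simp add: seg_def)

lemma seg_append: "a \<le> b \<Longrightarrow> b \<le> c \<Longrightarrow> seg m a b @ seg m b c = seg m a c"
  unfolding seg_def by (metis le_Suc_ex map_append upt_add_eq_append)

lemma seg_upd [simp]: "k < a \<or> b \<le> k \<Longrightarrow> seg (m(k := v)) a b = seg m a b"
  by (auto simp: seg_def)

lemma seg_cong: "(\<And>x. a \<le> x \<Longrightarrow> x < b \<Longrightarrow> m x = m' x) \<Longrightarrow> seg m a b = seg m' a b"
  by (auto simp: seg_def)

lemma sorted_abs_Cons: "sorted_abs (x # xs) \<longleftrightarrow> (\<forall>y\<in>set xs. \<bar>x\<bar> \<le> \<bar>y\<bar>) \<and> sorted_abs xs"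
  by (simp add: sorted_abs_def)

lemma sorted_abs_snoc: "sorted_abs (xs @ [x]) \<longleftrightarrow> (\<forall>y\<in>set xs. \<bar>y\<bar> \<le> \<bar>x\<bar>) \<and> sorted_abs xs"
  by (auto simp: sorted_abs_def sorted_append)

text \<open>Snapshot of merging the adjacent runs from \<open>a\<close> to \<open>e\<close> and from
  \<open>e\<close> to \<open>b\<close> into the memory from \<open>z\<close> on, with read positions
  \<open>i\<close>, \<open>j\<close> and write position \<open>k\<close>. Bounding written by unread
  elements keeps the output sorted.\<close>

definition merging ::
    "(nat \<Rightarrow> real) \<Rightarrow> nat \<Rightarrow> nat \<Rightarrow> nat \<Rightarrow> nat \<Rightarrow> (nat \<Rightarrow> real) \<Rightarrow> nat \<Rightarrow> nat \<Rightarrow> nat \<Rightarrow> bool" where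
  "merging m\<^sub>0 a e b z m i j k \<longleftrightarrow>
     a \<le> i \<and> i \<le> e \<and> e \<le> j \<and> j \<le> b \<and> b \<le> z \<and> k = z + (i - a) + (j - e) \<and> (\<forall>x<z. m x = m\<^sub>0 x) \<and>
     sorted_abs (seg m z k) \<and> sorted_abs (seg m i e) \<and> sorted_abs (seg m j b) \<and>
     (\<forall>x\<in>set (seg m z k). \<forall>y\<in>set (seg m i e) \<union> set (seg m j b). \<bar>x\<bar> \<le> \<bar>y\<bar>) \<and>
     mset (seg m z k) + mset (seg m i e) + mset (seg m j b) = mset (seg m\<^sub>0 a b)"

lemma merging_init:
  assumes "a \<le> e" "e \<le> b" "b \<le> z" "sorted_abs (seg m a e)" "sorted_abs (seg m e b)"
  shows "merging m a e b z m a e z"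
proof -
  have "mset (seg m a e) + mset (seg m e b) = mset (seg m a b)"
    using seg_append[OF assms(1,2)] by (metis mset_append)
  then show ?thesis using assms by (simp add: merging_def) (simp add: sorted_abs_def)
qed

text \<open>The conditional premise lets one rule serve both a comparison and an exhausted right
  run; sortedness extends the comparison of heads to all unread elements.\<close>

lemma merging_left:
  assumes inv: "merging m\<^sub>0 a e b z m i j k" and i: "i < e" and le: "j < b \<Longrightarrow> \<bar>m i\<bar> \<le> \<bar>m j\<bar>"
  shows "merging m\<^sub>0 a e b z (m(k := m i)) (Suc i) j (Suc k)"
proof -
  have bounds: "a \<le> i" "e \<le> j" "j \<le> b" "b \<le> z" "k = z + (i - a) + (j - e)"
    using inv by (simp_all add: merging_def)
  then have "z \<le> k" by simp
  have out: "seg (m(k := m i)) z (Suc k) = seg m z k @ [m i]"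
    using bounds \<open>z \<le> k\<close> by (simp add: seg_snoc)
  have left: "seg m i e = m i # seg m (Suc i) e" using i by (rule seg_Cons)
  have right: "\<forall>y\<in>set (seg m j b). \<bar>m i\<bar> \<le> \<bar>y\<bar>"
  proof (cases "j < b")
    case True
    then have "seg m j b = m j # seg m (Suc j) b" by (rule seg_Cons)
    moreover have "sorted_abs (seg m j b)" using inv by (simp add: merging_def)
    ultimately show ?thesis using le[OF True] by (auto simp: sorted_abs_Cons)
  qed simp
  show ?thesis
    using inv bounds \<open>z \<le> k\<close> i right unfolding merging_def out left
    by (auto simp: sorted_abs_Cons sorted_abs_snoc ball_Un)
qed

lemma merging_right:
  assumes inv: "merging m\<^sub>0 a e b z m i j k" and j: "j < b" and le: "i < e \<Longrightarrow> \<bar>m j\<bar> \<le> \<bar>m i\<bar>"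
  shows "merging m\<^sub>0 a e b z (m(k := m j)) i (Suc j) (Suc k)"
proof -
  have bounds: "a \<le> i" "i \<le> e" "e \<le> j" "b \<le> z" "k = z + (i - a) + (j - e)"
    using inv by (simp_all add: merging_def)
  then have "z \<le> k" by simp
  have out: "seg (m(k := m j)) z (Suc k) = seg m z k @ [m j]"
    using bounds \<open>z \<le> k\<close> by (simp add: seg_snoc)
  have right: "seg m j b = m j # seg m (Suc j) b" using j by (rule seg_Cons)
  have left: "\<forall>y\<in>set (seg m i e). \<bar>m j\<bar> \<le> \<bar>y\<bar>"
  proof (cases "i < e")
    case True
    then have "seg m i e = m i # seg m (Suc i) e" by (rule seg_Cons)
    moreover have "sorted_abs (seg m i e)" using inv by (simp add: merging_def)
    ultimately show ?thesis using le[OF True] by (auto simp: sorted_abs_Cons)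
  qed simp
  show ?thesis
    using inv bounds \<open>z \<le> k\<close> j left unfolding merging_def out right
    by (auto simp: sorted_abs_Cons sorted_abs_snoc ball_Un)
qed

text \<open>The output reaches full length only when both read positions are at the ends of their
  runs.\<close>

lemma merging_final:
  assumes "merging m\<^sub>0 a e b z m i j k" "k = z + (b - a)"
  shows "sorted_abs (seg m z k)" "mset (seg m z k) = mset (seg m\<^sub>0 a b)"
  using assms unfolding merging_def by auto

text \<open>
  Index registers of the sorting phase: 0 is the number of elements, 1 and 2 are the first and the last plus one index
  of the queued runs, 3 to 4 and 5 to 6 are the unread parts of the runs being merged, 7 is the
  write position, 8 holds the constant 1, 9 is register 1 plus 1, and 10 is the value of
  register 7 at which the merge is complete.
\<close>

definition merge_loop :: prog where
  "merge_loop = While (ILess 7 10)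
     (let left = straight [RLoad 0 3, RStore 7 0, IAdd 3 3 8, IAdd 7 7 8];
          right = straight [RLoad 1 5, RStore 7 1, IAdd 5 5 8, IAdd 7 7 8]
      in Cond (IEq 3 4) right (Cond (IEq 5 6) left (block
           [straight [RLoad 0 3, RLoad 1 5, RMul 2 0 0, RMul 3 1 1], Cond (RLess 3 2) right left])))"

lemma wp_merge_loop:
  assumes inv: "merging m\<^sub>0 a e b z (rmem s\<^sub>0) (ireg s\<^sub>0 3) (ireg s\<^sub>0 5) (ireg s\<^sub>0 7)"
    and regs: "ireg s\<^sub>0 4 = e" "ireg s\<^sub>0 6 = b" "ireg s\<^sub>0 8 = 1" "ireg s\<^sub>0 10 = z + (b - a)"
    and z: "ireg s\<^sub>0 7 = z"
  shows "wp merge_loop (\<lambda>t s. t \<le> 20 * (b - a) + 1 \<and> ireg s 7 = z + (b - a) \<and>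
    sorted_abs (seg (rmem s) z (z + (b - a))) \<and> mset (seg (rmem s) z (z + (b - a))) = mset (seg m\<^sub>0 a b) \<and>
    (\<forall>x<z. rmem s x = m\<^sub>0 x) \<and> imem s = imem s\<^sub>0 \<and> (\<forall>r\<in>{0, 1, 2, 8}. ireg s r = ireg s\<^sub>0 r)) s\<^sub>0"
proof -
  define I where "I s \<longleftrightarrow> merging m\<^sub>0 a e b z (rmem s) (ireg s 3) (ireg s 5) (ireg s 7) \<and>
    imem s = imem s\<^sub>0 \<and> (\<forall>r\<in>{0, 1, 2, 4, 6, 8, 10}. ireg s r = ireg s\<^sub>0 r)" for s :: state
  have I0: "I s\<^sub>0" using inv by (simp add: I_def)
  show ?thesis
    unfolding merge_loop_def Let_def
  proof (rule wp_mono[OF wp_While[where I = I and \<Phi> = "\<lambda>s. 20 * (z + (b - a) - ireg s 7)", OF I0]])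
    fix s assume I: "I s" and test: "holds (ILess 7 10) s"
    let ?m = "rmem s" and ?i = "ireg s 3" and ?j = "ireg s 5" and ?k = "ireg s 7"
    have regs': "ireg s 4 = e" "ireg s 6 = b" "ireg s 8 = 1" "ireg s 10 = z + (b - a)"
      using I regs by (simp_all add: I_def)
    have inv': "merging m\<^sub>0 a e b z ?m ?i ?j ?k" using I by (simp add: I_def)
    then have bounds: "a \<le> ?i" "?i \<le> e" "e \<le> ?j" "?j \<le> b" "?k = z + (?i - a) + (?j - e)"
      by (simp_all add: merging_def)
    have k: "?k < z + (b - a)" using test regs' by simp
    \<comment> \<open>The program compares squares in place of absolute values.\<close>
    have sq: "\<bar>y\<bar> \<le> \<bar>x\<bar>" if "y * y < x * x" for x y :: real
      using that abs_le_square_iff[of y x] by (simp add: power2_eq_square)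
    have sq': "\<bar>x\<bar> \<le> \<bar>y\<bar>" if "\<not> y * y < x * x" for x y :: real
      using that abs_le_square_iff[of x y] by (simp add: power2_eq_square)
    note left = merging_left[OF inv'] and right = merging_right[OF inv']
    \<comment> \<open>The write position is below its limit, so the runs are not both
      exhausted.\<close>
    consider "?i = e" "?j < b" | "?i < e" "?j = b" | "?i < e" "?j < b"
      using bounds k by linarith
    then show "wp (Cond (IEq 3 4) (straight [RLoad 1 5, RStore 7 1, IAdd 5 5 8, IAdd 7 7 8])
      (Cond (IEq 5 6) (straight [RLoad 0 3, RStore 7 0, IAdd 3 3 8, IAdd 7 7 8]) (block
           [straight [RLoad 0 3, RLoad 1 5, RMul 2 0 0, RMul 3 1 1], Cond (RLess 3 2)
             (straight [RLoad 1 5, RStore 7 1, IAdd 5 5 8, IAdd 7 7 8])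
             (straight [RLoad 0 3, RStore 7 0, IAdd 3 3 8, IAdd 7 7 8])])))
      (\<lambda>t s'. I s' \<and> t + 1 + 20 * (z + (b - a) - ireg s' 7) \<le> 20 * (z + (b - a) - ireg s 7)) s"
    proof cases
      case 1
      then show ?thesis using I right k regs regs' by (simp add: I_def)
    next
      case 2
      then show ?thesis using I left k regs regs' by (simp add: I_def)
    next
      case 3
      then show ?thesis using I left right k regs regs' sq[of "?m ?j" "?m ?i"] sq'[of "?m ?j" "?m ?i"]
        by (simp add: I_def)
    qed
  next
    fix t s assume *: "I s \<and> \<not> holds (ILess 7 10) s \<and> t \<le> 20 * (z + (b - a) - ireg s\<^sub>0 7) + 1"
    then have inv': "merging m\<^sub>0 a e b z (rmem s) (ireg s 3) (ireg s 5) (ireg s 7)" by (simp add: I_def)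
    have "ireg s 7 \<ge> z + (b - a)" using * regs by (simp add: I_def)
    then have k: "ireg s 7 = z + (b - a)" using inv' unfolding merging_def by linarith
    have frame: "\<forall>x<z. rmem s x = m\<^sub>0 x" using inv' by (simp add: merging_def)
    show "t \<le> 20 * (b - a) + 1 \<and> ireg s 7 = z + (b - a) \<and>
      sorted_abs (seg (rmem s) z (z + (b - a))) \<and> mset (seg (rmem s) z (z + (b - a))) = mset (seg m\<^sub>0 a b) \<and>
      (\<forall>x<z. rmem s x = m\<^sub>0 x) \<and> imem s = imem s\<^sub>0 \<and> (\<forall>r\<in>{0, 1, 2, 8}. ireg s r = ireg s\<^sub>0 r)"
      using * merging_final[OF inv' k] k z frame by (simp add: I_def)
  qed
qed

section \<open>Queue merge sort\<close>

text \<open>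
  Run \<open>i < n\<close> consists of the \<open>i\<close>-th input element, and run \<open>i \<ge> n\<close> is the merge of the runs
  \<open>2 * (i - n)\<close> and \<open>2 * (i - n) + 1\<close>, appended to the end of the used memory. Run \<open>i\<close> starts at
  address \<open>run_start n i\<close>. The case \<open>i \<ge> 2 * n\<close> is junk.
\<close>

function run_start :: "nat \<Rightarrow> nat \<Rightarrow> nat" where
  "run_start n i = (if i < n \<or> i \<ge> 2 * n then i else n + run_start n (2 * (i - n)))"
  by pat_completeness auto
text \<open>The recursive argument \<open>2 * (i - n)\<close> is below \<open>i\<close> exactly
  because the junk case is cut off at \<open>2 * n\<close>.\<close>

termination by (relation "measure snd") auto

declare run_start.simps [simp del]

lemma run_start_less: "i < n \<Longrightarrow> run_start n i = i"
  by (simp add: run_start.simps)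

text \<open>When run \<open>i\<close> is about to be written, the queue begins with run
  \<open>2 * (i - n)\<close> and spans exactly \<open>n\<close> cells.\<close>

lemma run_start_ge: "n \<le> i \<Longrightarrow> i < 2 * n \<Longrightarrow> run_start n i = n + run_start n (2 * (i - n))"
  by (simp add: run_start.simps[of n i])

lemma run_start_le: "i \<le> n \<Longrightarrow> run_start n i = i"
  by (cases "i < n") (auto simp: run_start_less run_start_ge run_start.simps)

text \<open>A merged run is as long as its two earlier source runs together, so lengths stay
  nonnegative.\<close>

lemma run_start_Suc: "Suc i < 2 * n \<Longrightarrow> run_start n i \<le> run_start n (Suc i)"
proof (induction i rule: less_induct)
  case (less i)
  show ?case
  proof (cases "i < n")
    case True
    then show ?thesis by (simp add: run_start_le)
  next
    case False
    let ?j = "2 * (i - n)"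
    have j: "Suc ?j < i" using False less.prems by linarith
    have "run_start n ?j \<le> run_start n (Suc ?j)" "run_start n (Suc ?j) \<le> run_start n (Suc (Suc ?j))"
      using j less.prems by (intro less.IH; simp)+
    then have "run_start n ?j \<le> run_start n (Suc (Suc ?j))" by simp
    then show ?thesis using False less.prems by (simp add: run_start_ge Suc_diff_le)
  qed
qed

lemma run_start_mono: "i \<le> j \<Longrightarrow> j < 2 * n \<Longrightarrow> run_start n i \<le> run_start n j"
proof (induction j rule: dec_induct)
  case (step j)
  then show ?case using run_start_Suc[of j n] by simp
qed simp

text \<open>
  The used memory has length \<open>run_start n (2 * n - 1)\<close>, so this bounds the total length of all
  merges. In terms of the distance \<open>2 * n - i\<close> to the end, unfolding \<open>run_start\<close> doubles it.
\<close>

lemma run_start_bound: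
  assumes "j \<le> k" "n \<le> 2 ^ k" "0 < n"
  shows "run_start n (2 * n - 2 ^ j) \<le> (k - j + 1) * n"
  using assms(1)
proof (induction j rule: inc_induct)
  case base
  have "2 * n - 2 ^ k \<le> n" using assms(2) by simp
  then show ?case by (simp add: run_start_le)
next
  case (step j)
  show ?case
  proof (cases "2 * n - 2 ^ j \<le> n")
    case True
    then show ?thesis by (simp add: run_start_le)
  next
    case False
    then have "run_start n (2 * n - 2 ^ j) = n + run_start n (2 * (2 * n - 2 ^ j - n))"
      using assms(3) by (intro run_start_ge) auto
    also have "2 * (2 * n - 2 ^ j - n) = 2 * n - 2 ^ Suc j" by simp
    also have "n + run_start n (2 * n - 2 ^ Suc j) \<le> n + (k - Suc j + 1) * n"
      using step.IH by simp
    also have "\<dots> = (k - j + 1) * n" using step.hyps by (simp add: Suc_diff_Suc flip: mult_Suc)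
    finally show ?thesis .
  qed
qed

definition sort_loop :: prog where
  "sort_loop = While (ILess 9 2) (block
     [straight [ILoad 3 1, ILoad 4 9, IMove 5 4, IAdd 9 9 8, ILoad 6 9, ISub 10 6 3, IAdd 10 7 10, IMove 1 9],
      merge_loop,
      straight [IAdd 2 2 8, IStore 2 7, IAdd 9 1 8]])"

text \<open>\<open>r\<close> counts the runs created so far; the \<open>r - n\<close> merges
  consumed two runs each, and the others are queued. Index cell \<open>r\<close> already holds the
  first free address, which ends the last run.\<close>

definition sorting :: "nat \<Rightarrow> real multiset \<Rightarrow> nat \<Rightarrow> state \<Rightarrow> bool" where
  "sorting n S r s \<longleftrightarrow> n \<le> r \<and> r < 2 * n \<and>
     ireg s 0 = n \<and> ireg s 1 = 2 * (r - n) \<and> ireg s 2 = r \<and> ireg s 7 = run_start n r \<and> ireg s 8 = 1 \<and>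
     ireg s 9 = Suc (2 * (r - n)) \<and> (\<forall>x\<le>r. imem s x = run_start n x) \<and>
     (\<forall>x. 2 * (r - n) \<le> x \<longrightarrow> x < r \<longrightarrow> sorted_abs (seg (rmem s) (run_start n x) (run_start n (Suc x)))) \<and>
     mset (seg (rmem s) (run_start n (2 * (r - n))) (run_start n r)) = S"

text \<open>A merge is charged to the length of the run it creates, so that the costs telescope over
  the loop.\<close>

lemma sorting_step:
  assumes inv: "sorting n S r s" and test: "Suc (2 * (r - n)) < r"
  shows "wp (block
     [straight [ILoad 3 1, ILoad 4 9, IMove 5 4, IAdd 9 9 8, ILoad 6 9, ISub 10 6 3, IAdd 10 7 10, IMove 1 9],
      merge_loop,
      straight [IAdd 2 2 8, IStore 2 7, IAdd 9 1 8]])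
    (\<lambda>t s'. sorting n S (Suc r) s' \<and> t \<le> 20 * (run_start n (Suc r) - run_start n r) + 20) s"
proof -
  let ?h = "2 * (r - n)"
  define a e b z where "a = run_start n ?h" and "e = run_start n (Suc ?h)"
    and "b = run_start n (Suc (Suc ?h))" and "z = run_start n r"
  have r: "n \<le> r" "Suc r < 2 * n" using inv test unfolding sorting_def by linarith+
  have ord: "a \<le> e" "e \<le> b" "b \<le> z"
    unfolding a_def e_def b_def z_def using test r by (intro run_start_mono; simp)+
  have z: "z = n + a" using r by (simp add: z_def a_def run_start_ge)
  have z': "run_start n (Suc r) = n + b" using r by (simp add: b_def run_start_ge Suc_diff_le)
  have len: "z + (b - a) = run_start n (Suc r)" using z z' ord by simp
  note inv' = inv[unfolded sorting_def]
  have srt: "sorted_abs (seg (rmem s) a e)" "sorted_abs (seg (rmem s) e b)"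
    using inv' test by (simp_all add: a_def e_def b_def)
  have mem: "imem s ?h = a" "imem s (Suc ?h) = e" "imem s (Suc (Suc ?h)) = b"
    using inv' test by (simp_all add: a_def e_def b_def)
  define s\<^sub>1 where "s\<^sub>1 = fold exec [ILoad 3 1, ILoad 4 9, IMove 5 4, IAdd 9 9 8, ILoad 6 9,
    ISub 10 6 3, IAdd 10 7 10, IMove 1 9] s"
  have s\<^sub>1: "rmem s\<^sub>1 = rmem s" "imem s\<^sub>1 = imem s" "ireg s\<^sub>1 3 = a" "ireg s\<^sub>1 5 = e" "ireg s\<^sub>1 7 = z"
    "ireg s\<^sub>1 4 = e" "ireg s\<^sub>1 6 = b" "ireg s\<^sub>1 8 = 1" "ireg s\<^sub>1 10 = z + (b - a)"
    "ireg s\<^sub>1 0 = n" "ireg s\<^sub>1 1 = Suc (Suc ?h)" "ireg s\<^sub>1 2 = r"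
    using inv' mem by (simp_all add: s\<^sub>1_def z_def)
  have "wp merge_loop (\<lambda>t s'. t \<le> 20 * (b - a) + 1 \<and> ireg s' 7 = z + (b - a) \<and>
    sorted_abs (seg (rmem s') z (z + (b - a))) \<and> mset (seg (rmem s') z (z + (b - a))) = mset (seg (rmem s) a b) \<and>
    (\<forall>x<z. rmem s' x = rmem s x) \<and> imem s' = imem s\<^sub>1 \<and> (\<forall>r\<in>{0, 1, 2, 8}. ireg s' r = ireg s\<^sub>1 r)) s\<^sub>1"
    by (rule wp_merge_loop[where e = e]) (use s\<^sub>1 merging_init[OF ord srt] in simp_all)
  then have "wp merge_loop (\<lambda>t s'. wp (straight [IAdd 2 2 8, IStore 2 7, IAdd 9 1 8])
    (\<lambda>u s''. sorting n S (Suc r) s'' \<and> 9 + (t + (u + 1)) \<le> 20 * (run_start n (Suc r) - run_start n r) + 20) s') s\<^sub>1"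
  proof (rule wp_mono)
    fix t and s' :: state
    assume *: "t \<le> 20 * (b - a) + 1 \<and> ireg s' 7 = z + (b - a) \<and>
      sorted_abs (seg (rmem s') z (z + (b - a))) \<and> mset (seg (rmem s') z (z + (b - a))) = mset (seg (rmem s) a b) \<and>
      (\<forall>x<z. rmem s' x = rmem s x) \<and> imem s' = imem s\<^sub>1 \<and> (\<forall>r\<in>{0, 1, 2, 8}. ireg s' r = ireg s\<^sub>1 r)"
    have frame: "seg (rmem s') x y = seg (rmem s) x y" if "y \<le> z" for x y
      using * that by (intro seg_cong) simp
    have runs: "sorted_abs (seg (rmem s') (run_start n x) (run_start n (Suc x)))"
      if "2 * (Suc r - n) \<le> x" "x < Suc r" for x
    proof (cases "x = r")
      case True
      then show ?thesis using * len by (simp add: z_def)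
    next
      case False
      then have "run_start n (Suc x) \<le> z"
        unfolding z_def using that r by (intro run_start_mono) auto
      then show ?thesis using that False inv' by (simp add: frame)
    qed
    \<comment> \<open>The elements of the two front runs leave the queue at its head and reappear at
      its tail.\<close>
    have "mset (seg (rmem s') b z) + mset (seg (rmem s') z (z + (b - a))) =
        mset (seg (rmem s) b z) + mset (seg (rmem s) a b)"
      using * frame by simp
    also have "\<dots> = mset (seg (rmem s) a z)"
      using seg_append[of a b z "rmem s"] ord by (metis add.commute le_trans mset_append)
    also have "\<dots> = S" using inv' by (simp add: a_def z_def)
    also have "mset (seg (rmem s') b z) + mset (seg (rmem s') z (z + (b - a))) =
        mset (seg (rmem s') b (z + (b - a)))"
      using seg_append[of b z "z + (b - a)" "rmem s'"] ord by (metis le_add1 mset_append)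
    finally have contents: "mset (seg (rmem s') b (run_start n (Suc r))) = S" by (simp add: len)
    have "run_start n (Suc (Suc ?h)) = b" "run_start n (Suc r) - z = b - a"
      using len by (simp_all add: b_def)
    then show "wp (straight [IAdd 2 2 8, IStore 2 7, IAdd 9 1 8])
      (\<lambda>u s''. sorting n S (Suc r) s'' \<and> 9 + (t + (u + 1)) \<le> 20 * (run_start n (Suc r) - run_start n r) + 20) s'"
      using contents * s\<^sub>1 r runs len inv'
      by (simp add: sorting_def Suc_diff_le le_Suc_eq flip: z_def) (use * in linarith)
  qed
  then show ?thesis by (simp add: s\<^sub>1_def)
qed

lemma wp_sort_loop:
  assumes "sorting n S n s"
  shows "wp sort_loop (\<lambda>t s'. sorting n S (2 * n - 1) s' \<and> t \<le> 21 * n + 20 * run_start n (2 * n - 1) + 1) s"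
  unfolding sort_loop_def
proof (rule wp_mono[OF wp_While[where I = "\<lambda>s. \<exists>r. sorting n S r s" and
      \<Phi> = "\<lambda>s. 21 * (2 * n - 1 - ireg s 2) + 20 * (run_start n (2 * n - 1) - ireg s 7)"]])
  show "\<exists>r. sorting n S r s" using assms by blast
next
  fix s assume "\<exists>r. sorting n S r s" and test: "holds (ILess 9 2) s"
  then obtain r where inv: "sorting n S r s" by blast
  then have test': "Suc (2 * (r - n)) < r" and regs: "ireg s 2 = r" "ireg s 7 = run_start n r"
    using test by (auto simp: sorting_def)
  then have r: "Suc r \<le> 2 * n - 1" using inv unfolding sorting_def by linarith
  have mono: "run_start n r \<le> run_start n (Suc r)" "run_start n (Suc r) \<le> run_start n (2 * n - 1)"
    using r by (intro run_start_mono; simp)+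
  show "wp (block
     [straight [ILoad 3 1, ILoad 4 9, IMove 5 4, IAdd 9 9 8, ILoad 6 9, ISub 10 6 3, IAdd 10 7 10, IMove 1 9],
      merge_loop,
      straight [IAdd 2 2 8, IStore 2 7, IAdd 9 1 8]])
    (\<lambda>t s'. (\<exists>r. sorting n S r s') \<and>
      t + 1 + (21 * (2 * n - 1 - ireg s' 2) + 20 * (run_start n (2 * n - 1) - ireg s' 7)) \<le>
      21 * (2 * n - 1 - ireg s 2) + 20 * (run_start n (2 * n - 1) - ireg s 7)) s"
  proof (rule wp_mono[OF sorting_step[OF inv test']], intro conjI)
    fix t s' assume *: "sorting n S (Suc r) s' \<and> t \<le> 20 * (run_start n (Suc r) - run_start n r) + 20"
    then show "\<exists>r. sorting n S r s'" by blast
    have "ireg s' 2 = Suc r" "ireg s' 7 = run_start n (Suc r)" using * by (simp_all add: sorting_def)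
    then show "t + 1 + (21 * (2 * n - 1 - ireg s' 2) + 20 * (run_start n (2 * n - 1) - ireg s' 7)) \<le>
      21 * (2 * n - 1 - ireg s 2) + 20 * (run_start n (2 * n - 1) - ireg s 7)"
      using conjunct2[OF *] r mono unfolding regs by linarith
  qed
next
  fix t s'
  assume *: "(\<exists>r. sorting n S r s') \<and> \<not> holds (ILess 9 2) s' \<and>
    t \<le> 21 * (2 * n - 1 - ireg s 2) + 20 * (run_start n (2 * n - 1) - ireg s 7) + 1"
  then obtain r where inv: "sorting n S r s'" by blast
  moreover from inv * have "\<not> Suc (2 * (r - n)) < r" by (auto simp: sorting_def)
  \<comment> \<open>The queue holds \<open>2 * n - r\<close> runs, at least one and now fewer than
    two.\<close>
  then have "r = 2 * n - 1" using inv unfolding sorting_def by linarith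
  moreover have "ireg s 2 = n" using assms by (simp add: sorting_def)
  ultimately show "sorting n S (2 * n - 1) s' \<and> t \<le> 21 * n + 20 * run_start n (2 * n - 1) + 1"
    using * by auto
qed

text \<open>Tabulates the starts of the singleton runs; the end of the last one, cell
  \<open>n\<close>, is stored right after this loop.\<close>

definition init_loop :: prog where
  "init_loop = While (ILess 1 0) (straight [IStore 1 1, IAdd 1 1 8])"

lemma wp_init_loop:
  assumes "ireg s\<^sub>0 0 = n" "ireg s\<^sub>0 1 = 0" "ireg s\<^sub>0 8 = 1"
  shows "wp init_loop (\<lambda>t s. t \<le> 4 * n + 1 \<and> ireg s 0 = n \<and> ireg s 1 = n \<and> ireg s 8 = 1 \<and>
    rmem s = rmem s\<^sub>0 \<and> (\<forall>x<n. imem s x = x)) s\<^sub>0"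
  unfolding init_loop_def
  by (rule wp_mono[OF wp_While[where \<Phi> = "\<lambda>s. 4 * (n - ireg s 1)" and
        I = "\<lambda>s. ireg s 0 = n \<and> ireg s 1 \<le> n \<and> ireg s 8 = 1 \<and> rmem s = rmem s\<^sub>0 \<and> (\<forall>x<ireg s 1. imem s x = x)"]])
    (use assms in \<open>auto simp: less_Suc_eq\<close>)

section \<open>Writing the zigzag arrangement\<close>

text \<open>Register 3 reads the sorted run; the output cells still open are those from register 4
  up to, but excluding, register 5.\<close>

definition zigzag_loop :: prog where
  "zigzag_loop = While (ILess 4 5) (block
     [straight [RLoad 0 3, RStore 4 0, IAdd 3 3 8, IAdd 4 4 8],
      Cond (ILess 4 5) (straight [RLoad 0 3, IAdd 3 3 8, ISub 5 5 8, RStore 5 0]) (straight [])])"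

text \<open>\<open>n \<le> p\<close> keeps the source clear of the output cells. The invariant
  places the zigzag of the unread part between the two finished ends.\<close>

lemma wp_zigzag_loop:
  assumes regs: "ireg s\<^sub>0 3 = p" "ireg s\<^sub>0 4 = 0" "ireg s\<^sub>0 5 = n" "ireg s\<^sub>0 8 = 1" and p: "n \<le> p"
  shows "wp zigzag_loop (\<lambda>t s. t \<le> 20 * n + 1 \<and> seg (rmem s) 0 n = zigzag (seg (rmem s\<^sub>0) p (p + n))) s\<^sub>0"
proof -
  define I where "I s \<longleftrightarrow> ireg s 8 = 1 \<and> ireg s 4 \<le> ireg s 5 \<and> ireg s 5 \<le> n \<and> p \<le> ireg s 3 \<and>
    ireg s 3 + (ireg s 5 - ireg s 4) = p + n \<and>
    seg (rmem s) 0 (ireg s 4) @ zigzag (seg (rmem s) (ireg s 3) (p + n)) @ seg (rmem s) (ireg s 5) n =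
      zigzag (seg (rmem s\<^sub>0) p (p + n))" for s :: state
  have I0: "I s\<^sub>0" using regs by (simp add: I_def)
  show ?thesis
    unfolding zigzag_loop_def
  proof (rule wp_mono[OF wp_While[where I = I and \<Phi> = "\<lambda>s. 20 * (ireg s 5 - ireg s 4)", OF I0]])
    fix s assume I: "I s" and "holds (ILess 4 5) s"
    define l h q m where "l = ireg s 4" and "h = ireg s 5" and "q = ireg s 3" and "m = rmem s"
    have lh: "l < h" "h \<le> n" "p \<le> q" "q + (h - l) = p + n"
      using I \<open>holds (ILess 4 5) s\<close> by (simp_all add: I_def l_def h_def q_def)
    have zz: "seg m 0 l @ zigzag (seg m q (p + n)) @ seg m h n = zigzag (seg (rmem s\<^sub>0) p (p + n))"
      using I by (simp add: I_def l_def h_def q_def m_def)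
    have one: "ireg s 8 = 1" using I by (simp add: I_def)
    show "wp (block
     [straight [RLoad 0 3, RStore 4 0, IAdd 3 3 8, IAdd 4 4 8],
      Cond (ILess 4 5) (straight [RLoad 0 3, IAdd 3 3 8, ISub 5 5 8, RStore 5 0]) (straight [])])
      (\<lambda>t s'. I s' \<and> t + 1 + 20 * (ireg s' 5 - ireg s' 4) \<le> 20 * (ireg s 5 - ireg s 4)) s"
    proof (cases "Suc l < h")
      case True
      obtain d where d: "h = Suc (Suc (l + d))"
        using less_imp_Suc_add[OF True] by auto
      define h' where "h' = Suc (l + d)"
      then have h': "h = Suc h'" using d by simp
      have src: "seg m q (p + n) = m q # m (Suc q) # seg m (Suc (Suc q)) (p + n)"
        using True lh by (simp add: seg_Cons)
      let ?m = "m(l := m q, h' := m (Suc q))"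
      have "seg ?m 0 (Suc l) = seg m 0 l @ [m q]" using True h' by (simp add: seg_snoc)
      moreover have "seg ?m h' n = m (Suc q) # seg m h n" using True lh h' by (simp add: seg_Cons)
      moreover have "seg ?m (Suc (Suc q)) (p + n) = seg m (Suc (Suc q)) (p + n)"
        using True lh h' p by simp
      ultimately have "seg ?m 0 (Suc l) @ zigzag (seg ?m (Suc (Suc q)) (p + n)) @ seg ?m h' n =
          zigzag (seg (rmem s\<^sub>0) p (p + n))"
        using zz src by simp
      moreover have "(m(l := m q)) (Suc q) = m (Suc q)" using lh p by simp
      ultimately show ?thesis
        using lh one d h'_def unfolding I_def by (simp flip: l_def h_def q_def m_def)
    next
      case False
      then have h: "h = Suc l" using lh by simp
      have src: "seg m q (p + n) = [m q]" using h lh by (simp add: seg_Cons)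
      let ?m = "m(l := m q)"
      have "seg ?m 0 (Suc l) = seg m 0 l @ [m q]" by (simp add: seg_snoc)
      moreover have "seg ?m h n = seg m h n" using h by simp
      moreover have "seg ?m (Suc q) (p + n) = []" using h lh by simp
      ultimately have "seg ?m 0 (Suc l) @ zigzag (seg ?m (Suc q) (p + n)) @ seg ?m h n =
          zigzag (seg (rmem s\<^sub>0) p (p + n))"
        using zz src by simp
      then show ?thesis
        using h lh one unfolding I_def by (simp flip: l_def h_def q_def m_def)
    qed
  next
    fix t s assume *: "I s \<and> \<not> holds (ILess 4 5) s \<and> t \<le> 20 * (ireg s\<^sub>0 5 - ireg s\<^sub>0 4) + 1"
    then have "seg (rmem s) 0 n = zigzag (seg (rmem s\<^sub>0) p (p + n))"
      using seg_append[of 0 "ireg s 5" n "rmem s"] by (auto simp: I_def)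
    then show "t \<le> 20 * n + 1 \<and> seg (rmem s) 0 n = zigzag (seg (rmem s\<^sub>0) p (p + n))"
      using * regs by simp
  qed
qed

definition zigzag_sort :: prog where
  "zigzag_sort = block
     [straight [IConst 8 1], init_loop,
      straight [IStore 1 1, IMove 2 0, IMove 7 0, IConst 1 0, IConst 9 1], sort_loop,
      straight [ILoad 3 1, IConst 4 0, IMove 5 0], zigzag_loop]"

lemma wp_zigzag_sort:
  assumes n: "length xs = n" "2 \<le> n"
  shows "wp zigzag_sort (\<lambda>t s. t \<le> 100 * n + 20 * run_start n (2 * n - 1) \<and>
    (\<exists>ys. mset ys = mset xs \<and> sorted_abs ys \<and> result n s = zigzag ys)) (init_state xs)"
proof -
  let ?s1 = "fold exec [IConst 8 1] (init_state xs)"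
  let ?b = "straight [IStore 1 1, IMove 2 0, IMove 7 0, IConst 1 0, IConst 9 1]"
  let ?c = "straight [ILoad 3 1, IConst 4 0, IMove 5 0]"
  have mem: "seg (rmem ?s1) 0 n = xs"
    using n by (auto simp: seg_def init_state_def intro!: nth_equalityI)
  have 1: "wp init_loop (\<lambda>t s. t \<le> 4 * n + 1 \<and> ireg s 0 = n \<and> ireg s 1 = n \<and> ireg s 8 = 1 \<and>
    rmem s = rmem ?s1 \<and> (\<forall>x<n. imem s x = x)) ?s1"
    by (rule wp_init_loop) (use n in \<open>simp_all add: init_state_def\<close>)
  have 2: "wp ?b (\<lambda>t s'. t = 6 \<and> sorting n (mset xs) n s') s"
    if "ireg s 0 = n \<and> ireg s 1 = n \<and> ireg s 8 = 1 \<and> rmem s = rmem ?s1 \<and> (\<forall>x<n. imem s x = x)" for s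
    using that n mem by (simp add: sorting_def run_start_le) (simp add: sorted_abs_def)
  have 3: "wp ?c (\<lambda>t s'. t = 4 \<and> ireg s' 3 = run_start n (2 * n - 2) \<and> ireg s' 4 = 0 \<and> ireg s' 5 = n \<and>
      ireg s' 8 = 1 \<and> (\<exists>ys. mset ys = mset xs \<and> sorted_abs ys \<and>
        seg (rmem s') (run_start n (2 * n - 2)) (run_start n (2 * n - 2) + n) = ys)) s"
    if "sorting n (mset xs) (2 * n - 1) s" for s
  proof -
    \<comment> \<open>Only run \<open>2 * n - 2\<close> is left in the queue, and it contains all
      \<open>n\<close> elements.\<close>
    have "2 * (2 * n - 1 - n) = 2 * n - 2" using n by simp
    moreover from this have "run_start n (2 * n - 1) = run_start n (2 * n - 2) + n"
      using n run_start_ge[of n "2 * n - 1"] by simp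
    moreover have "Suc (2 * n - 2) = 2 * n - 1" using n by simp
    ultimately show ?thesis
      using that n by (auto simp: sorting_def dest: spec[of _ "2 * n - 2"])
  qed
  \<comment> \<open>For \<open>2 \<le> n\<close> the final run is a merged one and hence lies beyond
    the input cells.\<close>
  have p: "n \<le> run_start n (2 * n - 2)" using n by (simp add: run_start_ge)
  show ?thesis
    unfolding zigzag_sort_def block.simps wp_Seq
    apply (rule wp_mono[where Q = "\<lambda>t s. t = 2 \<and> s = ?s1"])
     apply simp
    apply clarify
    apply (rule wp_mono[OF 1])
    apply (rule wp_mono[OF 2])
     apply blast
    apply (elim conjE)
    apply (rule wp_mono[OF wp_sort_loop], assumption)
    apply (elim conjE)
    apply (rule wp_mono[OF 3], assumption)
    apply (elim conjE exE)
    apply (rule wp_mono[OF wp_zigzag_loop[OF _ _ _ _ p]])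
    apply (assumption+)[4]
    using n
    apply (auto simp: result_def seg_def)
    done
qed

section \<open>Running time\<close>

text \<open>\<open>run_start_bound\<close> is used at distance \<open>2 ^ 0\<close> from the end;
  rounding the binary logarithm up costs at most one further \<open>n\<close> in the memory
  length.\<close>

lemma zigzag_sort_time:
  assumes "2 \<le> n"
  shows "real (100 * n + 20 * run_start n (2 * n - 1)) \<le> 140 * real n + 20 * real n * log 2 (real n)"
proof -
  define k where "k = nat \<lceil>log 2 (real n)\<rceil>"
  have log: "log 2 (real n) \<le> real k" "real k \<le> log 2 (real n) + 1"
    using assms zero_le_log_cancel_iff[of 2 "real n"] unfolding k_def by linarith+
  have "real n = 2 powr log 2 (real n)" using assms by simp
  also have "\<dots> \<le> 2 powr real k" using log(1) by simp
  also have "\<dots> = real (2 ^ k)" by (simp add: powr_realpow)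
  finally have "n \<le> 2 ^ k" by (simp only: of_nat_le_iff)
  then have "run_start n (2 * n - 1) \<le> (k + 1) * n"
    using run_start_bound[of 0 k n] assms by simp
  then have "real (run_start n (2 * n - 1)) \<le> (real k + 1) * real n"
    by (metis of_nat_1 of_nat_add of_nat_le_iff of_nat_mult)
  also have "\<dots> \<le> (log 2 (real n) + 2) * real n"
    using log(2) by (intro mult_right_mono) auto
  finally show ?thesis by (simp add: algebra_simps)
qed

lemma zigzag_sort_solves:
  assumes "\<And>ys. sorted_abs ys \<Longrightarrow> mset ys \<in> I \<Longrightarrow> solves_min_sum_abs_prefixsum (mset ys) (zigzag ys)"
    and size: "\<And>S. S \<in> I \<Longrightarrow> 2 \<le> size S"
  shows "min_sum_abs_prefixsum_solvable_in_time (\<lambda>n. real n * ln (real n)) I"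
  unfolding min_sum_abs_prefixsum_solvable_in_time_def
proof (intro exI[of _ zigzag_sort] exI[of _ "\<lambda>n. 140 * real n + 20 * real n * log 2 (real n)"]
    conjI ballI allI impI)
  show "(\<lambda>n. 140 * real n + 20 * real n * log 2 (real n)) \<in> O(\<lambda>n. real n * ln (real n))"
    unfolding log_def by real_asymp
next
  fix S xs assume S: "S \<in> I" and xs: "mset xs = S"
  have n: "length xs = size S" "2 \<le> size S" using xs size[OF S] by auto
  from wp_zigzag_sort[OF n] obtain t s ys where
    "runs zigzag_sort (init_state xs) t s" "t \<le> 100 * size S + 20 * run_start (size S) (2 * size S - 1)"
    "mset ys = S" "sorted_abs ys" "result (size S) s = zigzag ys"
    unfolding wp_def xs by blast
  moreover from this(2) have "real t \<le> 140 * real (size S) + 20 * real (size S) * log 2 (real (size S))"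
    using zigzag_sort_time[OF n(2)] by linarith
  moreover have "solves_min_sum_abs_prefixsum S (zigzag ys)"
    using assms(1) \<open>sorted_abs ys\<close> \<open>mset ys = S\<close> S by blast
  ultimately show "\<exists>t s. runs zigzag_sort (init_state xs) t s \<and>
      real t \<le> 140 * real (size S) + 20 * real (size S) * log 2 (real (size S)) \<and>
      solves_min_sum_abs_prefixsum S (result (size S) s)"
    by metis
qed

text \<open>A lone element with sum zero would be 0, which \<open>P\<close> excludes.\<close>

lemma size_ge_2:
  fixes S :: "real multiset"
  assumes "size {#s \<in># S. P s#} = 1" "sum_mset S = 0" "\<not> P 0"
  shows "2 \<le> size S"
proof (rule ccontr)
  assume "\<not> 2 \<le> size S"
  moreover have "S \<noteq> {#}" using assms(1) by auto
  then have "size S \<noteq> 0" by simp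
  ultimately have "size S = 1" by linarith
  then obtain x where "S = {#x#}" by (meson size_1_singleton_mset)
  then show False using assms by simp
qed

theorem theorem11:
  shows "min_sum_abs_prefixsum_solvable_in_time (\<lambda>n. real n * ln (real n))
             {S. size {#s \<in># S. s < 0#} = 1 \<and> (\<Sum>s\<in>#S. s) = 0} \<and>
         min_sum_abs_prefixsum_solvable_in_time (\<lambda>n. real n * ln (real n))
             {S. size {#s \<in># S. s > 0#} = 1 \<and> (\<Sum>s\<in>#S. s) = 0}"
proof (intro conjI zigzag_sort_solves)
  fix ys :: "real list"
  assume "sorted_abs ys" "mset ys \<in> {S. size {#s \<in># S. s < 0#} = 1 \<and> (\<Sum>s\<in>#S. s) = 0}"
  then show "solves_min_sum_abs_prefixsum (mset ys) (zigzag ys)"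
    by (intro zigzag_solves_one_negative) (simp_all add: sum_mset_sum_list)
next
  fix ys :: "real list"
  assume "sorted_abs ys" "mset ys \<in> {S. size {#s \<in># S. s > 0#} = 1 \<and> (\<Sum>s\<in>#S. s) = 0}"
  then show "solves_min_sum_abs_prefixsum (mset ys) (zigzag ys)"
    by (intro zigzag_solves_one_positive) (simp_all add: sum_mset_sum_list)
next
  fix S :: "real multiset"
  assume "S \<in> {S. size {#s \<in># S. s < 0#} = 1 \<and> (\<Sum>s\<in>#S. s) = 0}"
  then show "2 \<le> size S" using size_ge_2[of "\<lambda>s. s < 0" S] by simp
next
  fix S :: "real multiset"
  assume "S \<in> {S. size {#s \<in># S. s > 0#} = 1 \<and> (\<Sum>s\<in>#S. s) = 0}"
  then show "2 \<le> size S" using size_ge_2[of "\<lambda>s. s > 0" S] by simp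
qed

end
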